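(* Let $x,y,z\in\mathbb R^n$ be such that the triple $[x,y,z]$ is $\digamma$-right-angled in $z$. Then for all $p\in\mathbb N$, $$d_{\varphi_p}(x,y)^2=d_{\varphi_p}(x,z)^2\stackrel{p}{+}d_{\varphi_p}(y,z)^2,$$ and $$d_\boxplus(x,y)=\max\{d_\boxplus(x,z),d_\boxplus(y,z)\}.$$
   Context: Notation: $\mathbb N=\{0,1,2,\dots\}$, $[n]=\{1,\dots,n\}$. For $p\in\mathbb N$, $\varphi_p(\lambda)=\lambda^{2p+1}$ is a bijection of $\mathbb R$, and $\phi_p(x)=(\varphi_p(x_1),\dots,\varphi_p(x_n))$ on $\mathbb R^n$. For scalars $\lambda\stackrel{p}{+}\mu=\varphi_p^{-1}(\varphi_p(\lambda)+\varphi_p(\mu))$, applied coordinatewise to vectors, and $x\stackrel{p}{-}y=x\stackrel{p}{+}(-y)$. With $\|\cdot\|$ and $\langle\cdot,\cdot\rangle$ the Euclidean norm and inner product, set $\|x\|_{\varphi_p}=\varphi_p^{-1}(\|\phi_p(x)\|)$, $d_{\varphi_p}(x,y)=\|x\stackrel{p}{-}y\|_{\varphi_p}$, and $\langle x,y\rangle_p=\varphi_p^{-1}(\langle\phi_p(x),\phi_p(y)\rangle)=\big(\sum_{i\in[n]}x_i^{2p+1}y_i^{2p+1}\big)^{1/(2p+1)}$. For $u\in\mathbb R^m$, $\digamma_{[m]}(u)=\lim_{p\to\infty}\big(\sum_{i\in[m]}u_i^{2p+1}\big)^{1/(2p+1)}$. Explicitly: discard every index $i$ with $\mathrm{Card}\{j:u_j=u_i\}=\mathrm{Card}\{j:u_j=-u_i\}$;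 if no index remains, $\digamma_{[m]}(u)=0$; otherwise let $M$ be the maximum of $|u_i|$ over the remaining indices, and $\digamma_{[m]}(u)=M$ if $\mathrm{Card}\{j:u_j=M\}>\mathrm{Card}\{j:u_j=-M\}$, $\digamma_{[m]}(u)=-M$ otherwise. For $x,y,z\in\mathbb R^n$ define $\langle\!\langle x,y,z\rangle\!\rangle_\infty=\lim_{p\to\infty}\langle x\stackrel{p}{-}z,\,y\stackrel{p}{-}z\rangle_p=\digamma_{[4n]}(x_1y_1,\dots,x_ny_n,-x_1z_1,\dots,-x_nz_n,-y_1z_1,\dots,-y_nz_n,z_1^2,\dots,z_n^2)$. The triple $[x,y,z]$ is $\digamma$-right-angled in $z$ if $\langle\!\langle x,y,z\rangle\!\rangle_\infty=0$. For $\lambda,\mu\in\mathbb R$, $\lambda\boxplus\mu=\lambda$ if $|\lambda|>|\mu|$, $\frac12(\lambda+\mu)$ if $|\lambda|=|\mu|$, $\mu$ if $|\lambda|<|\mu|$; $\lambda\boxminus\mu=\lambda\boxplus(-\mu)$; and $d_\boxplus(x,y)=\max_{i\in[n]}|x_i\boxminus y_i|$. *)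

theory Defs
  imports "HOL-Analysis.Analysis"
begin

definition varphi :: "nat \<Rightarrow> real \<Rightarrow> real" where
  "varphi p l = l ^ (2 * p + 1)"

definition phi :: "nat \<Rightarrow> real ^ 'n \<Rightarrow> real ^ 'n" where
  "phi p x = (\<chi> i. varphi p (x $ i))"

lemma bij_varphi: "bij (varphi p)"
proof (rule o_bij)
  show "root (2 * p + 1) \<circ> varphi p = id"
    by (auto simp: varphi_def fun_eq_iff odd_real_root_power_cancel simp del: power_Suc)
  show "varphi p \<circ> root (2 * p + 1) = id"
    by (auto simp: varphi_def fun_eq_iff odd_real_root_pow simp del: power_Suc)
qed

lemma inv_varphi: "inv (varphi p) = root (2 * p + 1)"
proof (rule inv_unique_comp)
  show "root (2 * p + 1) \<circ> varphi p = id"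
    by (auto simp: varphi_def fun_eq_iff odd_real_root_power_cancel simp del: power_Suc)
  show "varphi p \<circ> root (2 * p + 1) = id"
    by (auto simp: varphi_def fun_eq_iff odd_real_root_pow simp del: power_Suc)
qed

definition padd :: "nat \<Rightarrow> real \<Rightarrow> real \<Rightarrow> real" where
  "padd p l m = inv (varphi p) (varphi p l + varphi p m)"

definition vpadd :: "nat \<Rightarrow> real ^ 'n \<Rightarrow> real ^ 'n \<Rightarrow> real ^ 'n" where
  "vpadd p x y = (\<chi> i. padd p (x $ i) (y $ i))"

definition vpdiff :: "nat \<Rightarrow> real ^ 'n \<Rightarrow> real ^ 'n \<Rightarrow> real ^ 'n" where
  "vpdiff p x y = vpadd p x (- y)"

definition pnorm :: "nat \<Rightarrow> real ^ 'n \<Rightarrow> real" where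
  "pnorm p x = inv (varphi p) (norm (phi p x))"

definition pdist :: "nat \<Rightarrow> real ^ 'n \<Rightarrow> real ^ 'n \<Rightarrow> real" where
  "pdist p x y = pnorm p (vpdiff p x y)"

definition pinner :: "nat \<Rightarrow> real ^ 'n \<Rightarrow> real ^ 'n \<Rightarrow> real" where
  "pinner p x y = inv (varphi p) (phi p x \<bullet> phi p y)"

text \<open>The triple product. The limit always exists and has the expected closed form, see
  \<open>triple_tendsto\<close>, \<open>triple_eq_digamma\<close> and \<open>digamma_eq_explicit\<close> below.\<close>

definition triple :: "real ^ 'n \<Rightarrow> real ^ 'n \<Rightarrow> real ^ 'n \<Rightarrow> real" where
  "triple x y z = lim (\<lambda>p. pinner p (vpdiff p x z) (vpdiff p y z))"

definition right_angled :: "real ^ 'n \<Rightarrow> real ^ 'n \<Rightarrow> real ^ 'n \<Rightarrow> bool" where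
  "right_angled x y z \<longleftrightarrow> triple x y z = 0"

definition boxplus :: "real \<Rightarrow> real \<Rightarrow> real" where
  "boxplus l m = (if \<bar>l\<bar> > \<bar>m\<bar> then l else if \<bar>l\<bar> = \<bar>m\<bar> then (l + m) / 2 else m)"

definition boxminus :: "real \<Rightarrow> real \<Rightarrow> real" where
  "boxminus l m = boxplus l (- m)"

definition boxdist :: "real ^ 'n \<Rightarrow> real ^ 'n \<Rightarrow> real" where
  "boxdist x y = (MAX i. \<bar>boxminus (x $ i) (y $ i)\<bar>)"

definition digamma :: "'i set \<Rightarrow> ('i \<Rightarrow> real) \<Rightarrow> real" where
  "digamma I u = lim (\<lambda>p. root (2 * p + 1) (\<Sum>i\<in>I. u i ^ (2 * p + 1)))"

definition remaining :: "'i set \<Rightarrow> ('i \<Rightarrow> real) \<Rightarrow> 'i set" where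
  "remaining I u = {i \<in> I. card {j \<in> I. u j = u i} \<noteq> card {j \<in> I. u j = - u i}}"

definition digamma_explicit :: "'i set \<Rightarrow> ('i \<Rightarrow> real) \<Rightarrow> real" where
  "digamma_explicit I u =
     (if remaining I u = {} then 0
      else let M = Max ((\<lambda>i. \<bar>u i\<bar>) ` remaining I u)
           in if card {j \<in> I. u j = M} > card {j \<in> I. u j = - M} then M else - M)"

lemma sum_odd_powers:
  fixes u :: "'i \<Rightarrow> real"
  assumes fin: "finite I" and odd: "odd k"
  shows "(\<Sum>i\<in>I. u i ^ k) =
    (\<Sum>v\<in>(\<lambda>i. \<bar>u i\<bar>) ` I. (real (card {j \<in> I. u j = v}) - real (card {j \<in> I. u j = - v})) * v ^ k)"
proof -
  have "(\<Sum>i\<in>{i \<in> I. \<bar>u i\<bar> = v}. u i ^ k) =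
      (real (card {j \<in> I. u j = v}) - real (card {j \<in> I. u j = - v})) * v ^ k"
    if "v \<in> (\<lambda>i. \<bar>u i\<bar>) ` I" for v
  proof (cases "v = 0")
    case True
    then show ?thesis using odd by (auto intro!: sum.neutral simp: odd_pos)
  next
    case False
    then have v: "v > 0" using that by auto
    have eq: "{i \<in> I. \<bar>u i\<bar> = v} = {j \<in> I. u j = v} \<union> {j \<in> I. u j = - v}" using v by auto
    have "(\<Sum>i\<in>{i \<in> I. \<bar>u i\<bar> = v}. u i ^ k) =
        (\<Sum>i\<in>{j \<in> I. u j = v}. u i ^ k) + (\<Sum>i\<in>{j \<in> I. u j = - v}. u i ^ k)"
      unfolding eq by (rule sum.union_disjoint) (use fin v in auto)
    then show ?thesis using odd by (simp add: algebra_simps)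
  qed
  then show ?thesis
    by (subst sum.image_gen[OF fin, of _ "\<lambda>i. \<bar>u i\<bar>"]) (rule sum.cong, auto)
qed

lemma root_odd_tendsto_one:
  fixes f :: "nat \<Rightarrow> real"
  assumes "f \<longlonglongrightarrow> c" "c > 0"
  shows "(\<lambda>p. root (2 * p + 1) (f p)) \<longlonglongrightarrow> 1"
proof -
  have ev: "\<forall>\<^sub>F p in sequentially. root (2 * p + 1) (f p) = f p powr (1 / real (2 * p + 1))"
    using order_tendstoD(1)[OF assms]
    by eventually_elim (simp add: root_powr_inverse del: of_nat_mult of_nat_add)
  have "(\<lambda>p. 1 / real (2 * p + 1)) \<longlonglongrightarrow> 0"
    by (rule LIMSEQ_subseq_LIMSEQ[OF lim_1_over_n, of "\<lambda>p. 2 * p + 1", unfolded o_def])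
       (auto simp: strict_mono_def)
  then have "(\<lambda>p. f p powr (1 / real (2 * p + 1))) \<longlonglongrightarrow> c powr 0"
    by (intro tendsto_powr assms(1)) (use assms(2) in auto)
  then show ?thesis using assms(2) ev by (simp add: tendsto_cong del: of_nat_mult of_nat_add)
qed

lemma root_odd_tendsto_sgn:
  fixes f :: "nat \<Rightarrow> real"
  assumes "f \<longlonglongrightarrow> c" "c \<noteq> 0"
  shows "(\<lambda>p. root (2 * p + 1) (f p)) \<longlonglongrightarrow> sgn c"
proof (cases "c > 0")
  case True
  then show ?thesis using root_odd_tendsto_one[OF assms(1)] by simp
next
  case False
  then have "(\<lambda>p. root (2 * p + 1) (- f p)) \<longlonglongrightarrow> 1"
    using assms by (intro root_odd_tendsto_one[of _ "- c"] tendsto_minus) auto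
  then have "(\<lambda>p. - root (2 * p + 1) (- f p)) \<longlonglongrightarrow> - 1" by (rule tendsto_minus)
  then show ?thesis using False assms(2) by (simp add: real_root_minus)
qed

lemma digamma_tendsto_explicit:
  assumes fin: "finite I"
  shows "(\<lambda>p. root (2 * p + 1) (\<Sum>i\<in>I. u i ^ (2 * p + 1))) \<longlonglongrightarrow> digamma_explicit I u"
proof -
  define c where "c v = real (card {j \<in> I. u j = v}) - real (card {j \<in> I. u j = - v})" for v
  let ?V = "(\<lambda>i. \<bar>u i\<bar>) ` I"
  define W where "W = (\<lambda>i. \<bar>u i\<bar>) ` remaining I u"
  have sub: "remaining I u \<subseteq> I" by (auto simp: remaining_def)
  have finR: "finite (remaining I u)" using sub fin by (rule finite_subset)
  have finW: "finite W" using finR by (simp add: W_def)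
  have WV: "W \<subseteq> ?V" using sub by (auto simp: W_def)
  have cW: "c v = 0" if "v \<in> ?V - W" for v
    using that by (auto simp: W_def remaining_def c_def abs_if split: if_splits)
  have cW': "c v \<noteq> 0" if "v \<in> W" for v
    using that by (auto simp: W_def remaining_def c_def abs_if split: if_splits)
  have S: "(\<Sum>i\<in>I. u i ^ (2 * p + 1)) = (\<Sum>v\<in>W. c v * v ^ (2 * p + 1))" for p
  proof -
    have "(\<Sum>i\<in>I. u i ^ (2 * p + 1)) = (\<Sum>v\<in>?V. c v * v ^ (2 * p + 1))"
      unfolding c_def by (rule sum_odd_powers[OF fin]) simp
    also have "\<dots> = (\<Sum>v\<in>W. c v * v ^ (2 * p + 1))"
      by (rule sum.mono_neutral_right) (use fin WV cW in auto)
    finally show ?thesis .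
  qed
  show ?thesis
  proof (cases "remaining I u = {}")
    case True
    then have "W = {}" by (simp add: W_def)
    then show ?thesis unfolding S using True by (simp add: digamma_explicit_def)
  next
    case False
    then have Wne: "W \<noteq> {}" by (simp add: W_def)
    define M where "M = Max W"
    have MW: "M \<in> W" unfolding M_def using finW Wne by (rule Max_in)
    have M0: "M \<noteq> 0" using cW'[OF MW] by (auto simp: c_def)
    have Wpos: "v \<ge> 0" if "v \<in> W" for v using that by (auto simp: W_def)
    have Mpos: "M > 0" using M0 Wpos[OF MW] by simp
    define f where "f p = (\<Sum>v\<in>W. c v * (v / M) ^ (2 * p + 1))" for p
    have rt: "root (2 * p + 1) (\<Sum>i\<in>I. u i ^ (2 * p + 1)) = M * root (2 * p + 1) (f p)" for p
    proof -
      have "(\<Sum>v\<in>W. c v * v ^ (2 * p + 1)) = M ^ (2 * p + 1) * f p"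
        unfolding f_def sum_distrib_left
        by (rule sum.cong) (use Mpos in \<open>auto simp: power_divide field_simps\<close>)
      then show ?thesis unfolding S
        by (simp only: real_root_mult) (simp add: odd_real_root_power_cancel del: power_Suc)
    qed
    have "f \<longlonglongrightarrow> (\<Sum>v\<in>W. if v = M then c v else 0)"
      unfolding f_def
    proof (rule tendsto_sum)
      fix v assume v: "v \<in> W"
      show "(\<lambda>p. c v * (v / M) ^ (2 * p + 1)) \<longlonglongrightarrow> (if v = M then c v else 0)"
      proof (cases "v = M")
        case True
        then show ?thesis using Mpos by simp
      next
        case False
        then have "v < M" using Max_ge[OF finW v] unfolding M_def by linarith
        then have "(\<lambda>k. (v / M) ^ k) \<longlonglongrightarrow> 0"
          using Mpos Wpos[OF v] by (intro LIMSEQ_power_zero) simp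
        from LIMSEQ_subseq_LIMSEQ[OF this, of "\<lambda>p. 2 * p + 1"]
        have "(\<lambda>p. (v / M) ^ (2 * p + 1)) \<longlonglongrightarrow> 0"
          by (simp add: o_def strict_mono_def)
        from tendsto_mult_left[OF this, of "c v"] show ?thesis using False by simp
      qed
    qed
    then have "f \<longlonglongrightarrow> c M" using MW finW by simp
    from tendsto_mult_left[OF root_odd_tendsto_sgn[OF this cW'[OF MW]], of M]
    have "(\<lambda>p. root (2 * p + 1) (\<Sum>i\<in>I. u i ^ (2 * p + 1))) \<longlonglongrightarrow> M * sgn (c M)"
      unfolding rt .
    moreover have "digamma_explicit I u = M * sgn (c M)"
      using False cW'[OF MW]
      by (auto simp: digamma_explicit_def Let_def M_def[symmetric] W_def[symmetric]
               c_def sgn_if)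
    ultimately show ?thesis by simp
  qed
qed

lemma digamma_eq_explicit: "finite I \<Longrightarrow> digamma I u = digamma_explicit I u"
  unfolding digamma_def by (rule limI[OF digamma_tendsto_explicit])

text \<open>The family of the 4n products, indexed by the disjoint sum of four copies of the
  coordinate type.\<close>

definition triple_family ::
    "real ^ 'n \<Rightarrow> real ^ 'n \<Rightarrow> real ^ 'n \<Rightarrow> 'n + 'n + 'n + 'n \<Rightarrow> real" where
  "triple_family x y z =
     case_sum (\<lambda>i. x $ i * y $ i)
       (case_sum (\<lambda>i. - (x $ i * z $ i))
         (case_sum (\<lambda>i. - (y $ i * z $ i)) (\<lambda>i. z $ i * z $ i)))"

lemma phi_vpdiff: "phi p (vpdiff p x y) = phi p x - phi p y"
proof -
  have "varphi p (inv (varphi p) t) = t" for t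
    using bij_varphi by (simp add: bij_is_surj surj_f_inv_f)
  then show ?thesis
    by (simp add: phi_def vpdiff_def vpadd_def padd_def vec_eq_iff) (simp add: varphi_def)
qed

lemma pinner_vpdiff:
  fixes x y z :: "real ^ 'n"
  shows "pinner p (vpdiff p x z) (vpdiff p y z) =
    root (2 * p + 1) (\<Sum>i\<in>UNIV. triple_family x y z i ^ (2 * p + 1))"
proof -
  have "(\<Sum>i\<in>UNIV. triple_family x y z i ^ (2 * p + 1)) =
      (\<Sum>i\<in>UNIV. (x $ i * y $ i) ^ (2 * p + 1)) + ((\<Sum>i\<in>UNIV. (- (x $ i * z $ i)) ^ (2 * p + 1)) +
      ((\<Sum>i\<in>UNIV. (- (y $ i * z $ i)) ^ (2 * p + 1)) + (\<Sum>i\<in>UNIV. (z $ i * z $ i) ^ (2 * p + 1))))"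
    by (simp only: UNIV_Plus_UNIV[symmetric] sum.Plus finite finite_Plus triple_family_def
          sum.case o_def)
  also have "\<dots> = (phi p x - phi p z) \<bullet> (phi p y - phi p z)"
    by (simp add: inner_vec_def phi_def varphi_def algebra_simps power_mult_distrib
          flip: sum.distrib sum_subtractf sum_negf del: power_Suc)
  finally show ?thesis by (simp add: pinner_def phi_vpdiff inv_varphi)
qed

lemma triple_tendsto:
  "(\<lambda>p. pinner p (vpdiff p x z) (vpdiff p y z)) \<longlonglongrightarrow> triple x y z"
  using digamma_tendsto_explicit[of UNIV "triple_family x y z"] unfolding triple_def pinner_vpdiff
  by (simp add: limI)

lemma triple_eq_digamma: "triple x y z = digamma UNIV (triple_family x y z)"
  by (simp add: triple_def digamma_def pinner_vpdiff)

end

theory Submission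
  imports Defs
begin

text \<open>The defining limit of a \<open>\<digamma>\<close>-right-angled triple vanishes only when the \<open>4n\<close> products cancel
  in pairs \<open>v, -v\<close>. Hence all their odd power sums vanish, so \<open>\<phi>\<^sub>p x - \<phi>\<^sub>p z\<close> and
  \<open>\<phi>\<^sub>p y - \<phi>\<^sub>p z\<close> are orthogonal for every \<open>p\<close>, and the first identity is Pythagoras'
  theorem. The second one is its limit for \<open>p \<rightarrow> \<infinity>\<close>, because \<open>d\<^sub>\<phi>\<^sub>p\<close> tends
  to \<open>d\<^sub>\<boxplus>\<close>.\<close>

text \<open>A nonempty remainder gives a value \<open>M\<close> or \<open>- M\<close> with
  \<open>M\<close> attained as some \<open>\<bar>u i\<bar>\<close>. Such an \<open>M\<close> is
  nonzero: an index with \<open>u i = 0\<close> is always discarded, because \<open>0 = - 0\<close>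
  makes its two cardinalities equal.\<close>

lemma digamma_explicit_eq_0_iff:
  assumes "finite I"
  shows "digamma_explicit I u = 0 \<longleftrightarrow> remaining I u = {}"
proof
  assume 0: "digamma_explicit I u = 0"
  show "remaining I u = {}"
  proof (rule ccontr)
    assume ne: "remaining I u \<noteq> {}"
    have "finite (remaining I u)" using assms by (simp add: remaining_def)
    then have "Max ((\<lambda>i. \<bar>u i\<bar>) ` remaining I u) \<in> (\<lambda>i. \<bar>u i\<bar>) ` remaining I u"
      using ne by (intro Max_in) auto
    moreover have "Max ((\<lambda>i. \<bar>u i\<bar>) ` remaining I u) = 0"
      using 0 ne by (auto simp: digamma_explicit_def Let_def split: if_splits)
    ultimately show False by (auto simp: remaining_def)
  qed
qed (simp add: digamma_explicit_def)

text \<open>After grouping by absolute value, the coefficient of each \<open>v ^ k\<close> is the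
  difference of the two cardinalities compared in \<open>remaining\<close>. Replacing
  \<open>u i\<close> by \<open>- u i\<close> only flips its sign, so the sign of the representative
  is irrelevant.\<close>

lemma sum_odd_powers_eq_0:
  assumes "finite I" "odd k" "remaining I u = {}"
  shows "(\<Sum>i\<in>I. u i ^ k) = 0"
  unfolding sum_odd_powers[OF assms(1,2)]
proof (rule sum.neutral, rule ballI)
  fix v assume "v \<in> (\<lambda>i. \<bar>u i\<bar>) ` I"
  then obtain i where i: "i \<in> I" "v = \<bar>u i\<bar>" by auto
  then have "card {j \<in> I. u j = u i} = card {j \<in> I. u j = - u i}"
    using assms(3) by (auto simp: remaining_def)
  then show "(real (card {j \<in> I. u j = v}) - real (card {j \<in> I. u j = - v})) * v ^ k = 0"
    using i by (auto simp: abs_if)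
qed

lemma right_angled_imp_orthogonal:
  assumes "right_angled x y z"
  shows "(phi p x - phi p z) \<bullet> (phi p y - phi p z) = 0"
proof -
  have "remaining UNIV (triple_family x y z) = {}"
    using assms digamma_explicit_eq_0_iff[of UNIV "triple_family x y z"]
    by (simp add: right_angled_def triple_eq_digamma digamma_eq_explicit)
  then have "pinner p (vpdiff p x z) (vpdiff p y z) = 0"
    unfolding pinner_vpdiff by (subst sum_odd_powers_eq_0) auto
  then show ?thesis by (simp add: pinner_def phi_vpdiff inv_varphi)
qed

text \<open>Odd roots commute with squaring. Together with \<open>padd_root\<close> this reduces the
  first identity to an equation between squared Euclidean norms.\<close>

lemma pdist_power2: "(pdist p x y)\<^sup>2 = root (2 * p + 1) ((norm (phi p x - phi p y))\<^sup>2)"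
  by (simp add: pdist_def pnorm_def phi_vpdiff inv_varphi real_root_power)

lemma padd_root: "padd p (root (2 * p + 1) a) (root (2 * p + 1) b) = root (2 * p + 1) (a + b)"
  by (simp add: padd_def inv_varphi varphi_def odd_real_root_pow del: power_Suc)

lemma padd_commute: "padd p a b = padd p b a"
  by (simp add: padd_def add.commute)

text \<open>Factoring out \<open>a\<close> leaves the root of a sequence with positive limit 1,
  since \<open>\<bar>b / a\<bar> < 1\<close>.\<close>

lemma padd_tendsto_dominant:
  assumes "\<bar>b\<bar> < \<bar>a\<bar>"
  shows "(\<lambda>p. padd p a b) \<longlonglongrightarrow> a"
proof -
  have a0: "a \<noteq> 0" using assms by auto
  have eq: "padd p a b = a * root (2 * p + 1) (1 + (b / a) ^ (2 * p + 1))" for p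
  proof -
    have "a ^ (2 * p + 1) + b ^ (2 * p + 1) = a ^ (2 * p + 1) * (1 + (b / a) ^ (2 * p + 1))"
      using a0 by (simp add: power_divide distrib_left del: power_Suc)
    then show ?thesis
      by (simp only: padd_def inv_varphi varphi_def real_root_mult)
        (simp add: odd_real_root_power_cancel del: power_Suc)
  qed
  have "(\<lambda>k. (b / a) ^ k) \<longlonglongrightarrow> 0"
    using assms a0 by (intro LIMSEQ_power_zero) simp
  from LIMSEQ_subseq_LIMSEQ[OF this, of "\<lambda>p. 2 * p + 1"]
  have "(\<lambda>p. 1 + (b / a) ^ (2 * p + 1)) \<longlonglongrightarrow> 1 + 0"
    by (intro tendsto_add) (simp_all add: o_def strict_mono_def)
  then have "(\<lambda>p. root (2 * p + 1) (1 + (b / a) ^ (2 * p + 1))) \<longlonglongrightarrow> 1"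
    by (rule root_odd_tendsto_one) simp
  from tendsto_mult_left[OF this, of a] show ?thesis unfolding eq by simp
qed

lemma padd_tendsto_boxplus: "(\<lambda>p. padd p a b) \<longlonglongrightarrow> boxplus a b"
proof -
  consider "\<bar>b\<bar> < \<bar>a\<bar>" | "\<bar>a\<bar> < \<bar>b\<bar>" | "b = a" | "b = - a" by linarith
  then show ?thesis
  proof cases
    case 1
    then show ?thesis using padd_tendsto_dominant[of b a] by (simp add: boxplus_def)
  next
    case 2
    then show ?thesis using padd_tendsto_dominant[of a b]
      by (simp add: boxplus_def padd_commute[of _ a])
  next
    \<comment> \<open>Equal arguments produce the factor \<open>root (2 * p + 1) 2\<close>, which
      tends to 1, so the limit is the mean of the two; opposite arguments cancel exactly for every
      \<open>p\<close>.\<close>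
    case 3
    have eq: "padd p a a = a * root (2 * p + 1) 2" for p
    proof -
      have "a ^ (2 * p + 1) + a ^ (2 * p + 1) = a ^ (2 * p + 1) * 2" by simp
      then show ?thesis
        by (simp only: padd_def inv_varphi varphi_def real_root_mult)
          (simp add: odd_real_root_power_cancel del: power_Suc)
    qed
    have "(\<lambda>p. a * root (2 * p + 1) 2) \<longlonglongrightarrow> a * 1"
      by (intro tendsto_mult_left root_odd_tendsto_one[OF tendsto_const]) simp
    then show ?thesis using 3 by (simp add: eq boxplus_def)
  next
    case 4
    then show ?thesis by (simp add: padd_def inv_varphi varphi_def boxplus_def)
  qed
qed

lemma tendsto_Max_image:
  fixes f :: "'i \<Rightarrow> 'a \<Rightarrow> real"
  assumes "finite I" "I \<noteq> {}" "\<And>i. i \<in> I \<Longrightarrow> (f i \<longlongrightarrow> l i) F"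
  shows "((\<lambda>x. MAX i\<in>I. f i x) \<longlongrightarrow> (MAX i\<in>I. l i)) F"
  using assms
proof (induction I rule: finite_ne_induct)
  case (insert i I)
  then show ?case by (simp add: tendsto_max)
qed simp

text \<open>The \<open>\<ell>\<^sup>k\<close> norm lies between the maximum \<open>m\<close> and \<open>root k (card I) * m\<close>.\<close>

lemma root_sum_powers_tendsto_Max:
  fixes u :: "'i \<Rightarrow> nat \<Rightarrow> real"
  assumes I: "finite I" "I \<noteq> {}"
    and nonneg: "\<And>i p. i \<in> I \<Longrightarrow> 0 \<le> u i p"
    and lim: "\<And>i. i \<in> I \<Longrightarrow> u i \<longlonglongrightarrow> l i"
  shows "(\<lambda>p. root (2 * p + 1) (\<Sum>i\<in>I. u i p ^ (2 * p + 1))) \<longlonglongrightarrow> (MAX i\<in>I. l i)"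
proof (rule tendsto_sandwich[OF always_eventually always_eventually])
  let ?m = "\<lambda>p. MAX i\<in>I. u i p"
  have M: "?m \<longlonglongrightarrow> (MAX i\<in>I. l i)"
    by (rule tendsto_Max_image[OF I lim])
  then show "?m \<longlonglongrightarrow> (MAX i\<in>I. l i)" .
  \<comment> \<open>The roots of the positive constant \<open>card I\<close> tend to 1, so both
    bounds share one limit.\<close>
  have "(\<lambda>p. root (2 * p + 1) (card I)) \<longlonglongrightarrow> 1"
    by (rule root_odd_tendsto_one[OF tendsto_const]) (use I in \<open>simp add: card_gt_0_iff\<close>)
  from tendsto_mult[OF this M]
  show "(\<lambda>p. root (2 * p + 1) (card I) * ?m p) \<longlonglongrightarrow> (MAX i\<in>I. l i)" by simp
  have in_I: "?m p \<in> (\<lambda>i. u i p) ` I" for p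
    using I by (intro Max_in) auto
  have le: "u i p \<le> ?m p" if "i \<in> I" for i p
    using I that by (intro Max_ge) auto
  show "\<forall>p. ?m p \<le> root (2 * p + 1) (\<Sum>i\<in>I. u i p ^ (2 * p + 1))"
  proof
    fix p
    obtain i where i: "i \<in> I" "?m p = u i p" using in_I[of p] by blast
    have "u i p ^ (2 * p + 1) \<le> (\<Sum>i\<in>I. u i p ^ (2 * p + 1))"
      by (rule member_le_sum) (use I i nonneg in auto)
    then have "root (2 * p + 1) (u i p ^ (2 * p + 1)) \<le> root (2 * p + 1) (\<Sum>i\<in>I. u i p ^ (2 * p + 1))"
      by (intro real_root_le_mono) auto
    then show "?m p \<le> root (2 * p + 1) (\<Sum>i\<in>I. u i p ^ (2 * p + 1))"
      unfolding i(2) by (subst (asm) odd_real_root_power_cancel) auto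
  qed
  show "\<forall>p. root (2 * p + 1) (\<Sum>i\<in>I. u i p ^ (2 * p + 1)) \<le> root (2 * p + 1) (card I) * ?m p"
  proof
    fix p
    have "(\<Sum>i\<in>I. u i p ^ (2 * p + 1)) \<le> card I * ?m p ^ (2 * p + 1)"
      by (rule sum_bounded_above) (intro power_mono le nonneg)
    then have "root (2 * p + 1) (\<Sum>i\<in>I. u i p ^ (2 * p + 1))
        \<le> root (2 * p + 1) (card I * ?m p ^ (2 * p + 1))"
      by (intro real_root_le_mono) auto
    also have "\<dots> = root (2 * p + 1) (card I) * ?m p"
      unfolding real_root_mult by (subst odd_real_root_power_cancel) auto
    finally show "root (2 * p + 1) (\<Sum>i\<in>I. u i p ^ (2 * p + 1)) \<le> root (2 * p + 1) (card I) * ?m p" .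
  qed
qed

lemma boxdist_nonneg: "0 \<le> boxdist x y"
proof -
  \<comment> \<open>Here \<open>undefined\<close> is just some coordinate; any other would
    do.\<close>
  have "\<bar>boxminus (x $ undefined) (y $ undefined)\<bar> \<le> boxdist x y"
    unfolding boxdist_def by (intro Max_ge) auto
  then show ?thesis by linarith
qed

lemma boxdist_power2: "(boxdist x y)\<^sup>2 = (MAX i. (boxminus (x $ i) (y $ i))\<^sup>2)"
proof (rule antisym)
  have "boxdist x y \<in> range (\<lambda>i. \<bar>boxminus (x $ i) (y $ i)\<bar>)"
    unfolding boxdist_def by (intro Max_in) auto
  then obtain i where "boxdist x y = \<bar>boxminus (x $ i) (y $ i)\<bar>" by blast
  then have "(boxdist x y)\<^sup>2 = (boxminus (x $ i) (y $ i))\<^sup>2" by simp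
  then show "(boxdist x y)\<^sup>2 \<le> (MAX i. (boxminus (x $ i) (y $ i))\<^sup>2)"
    by (intro Max_ge) auto
  have "(boxminus (x $ i) (y $ i))\<^sup>2 \<le> (boxdist x y)\<^sup>2" for i
  proof -
    have "\<bar>boxminus (x $ i) (y $ i)\<bar> \<le> boxdist x y"
      unfolding boxdist_def by (intro Max_ge) auto
    then show ?thesis by (simp add: abs_le_square_iff[symmetric] boxdist_nonneg)
  qed
  then show "(MAX i. (boxminus (x $ i) (y $ i))\<^sup>2) \<le> (boxdist x y)\<^sup>2"
    by (intro Max.boundedI) auto
qed

text \<open>The squared distance is the \<ell>-norm of exponent \<open>2 * p + 1\<close> of the
  squared coordinate differences. These are nonnegative and themselves vary with \<open>p\<close>,
  as \<open>root_sum_powers_tendsto_Max\<close> permits.\<close>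

lemma pdist_power2_tendsto: "(\<lambda>p. (pdist p x y)\<^sup>2) \<longlonglongrightarrow> (boxdist x y)\<^sup>2"
proof -
  have "(norm (phi p x - phi p y))\<^sup>2 = (\<Sum>i\<in>UNIV. ((padd p (x $ i) (- y $ i))\<^sup>2) ^ (2 * p + 1))" for p
  proof -
    have "((padd p a (- b))\<^sup>2) ^ (2 * p + 1) = (varphi p a - varphi p b)\<^sup>2" for a b
    proof -
      have "padd p a (- b) ^ (2 * p + 1) = varphi p a - varphi p b"
        unfolding padd_def inv_varphi by (subst odd_real_root_pow) (auto simp: varphi_def)
      then show ?thesis by (metis mult.commute power_mult)
    qed
    then show ?thesis
      by (simp add: power2_norm_eq_inner inner_vec_def phi_def flip: power2_eq_square)
  qed
  moreover have "(\<lambda>p. root (2 * p + 1)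
      (\<Sum>i\<in>UNIV. ((padd p (x $ i) (- y $ i))\<^sup>2) ^ (2 * p + 1))) \<longlonglongrightarrow> (boxdist x y)\<^sup>2"
    unfolding boxdist_power2 boxminus_def
    by (rule root_sum_powers_tendsto_Max) (auto intro!: tendsto_power padd_tendsto_boxplus)
  ultimately show ?thesis by (simp add: pdist_power2)
qed

text \<open>On nonnegative numbers \<open>padd p\<close> is the same kind of norm for a family of
  two members, here indexed by \<open>bool\<close>.\<close>

lemma padd_tendsto_max:
  assumes "\<And>p. 0 \<le> f p" "\<And>p. 0 \<le> g p" "f \<longlonglongrightarrow> a" "g \<longlonglongrightarrow> b"
  shows "(\<lambda>p. padd p (f p) (g p)) \<longlonglongrightarrow> max a b"
proof -
  have "(\<lambda>p. root (2 * p + 1) (\<Sum>i\<in>UNIV. (if i then f p else g p) ^ (2 * p + 1)))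
      \<longlonglongrightarrow> (MAX i. if i then a else b)"
    by (rule root_sum_powers_tendsto_Max) (use assms in auto)
  then show ?thesis
    by (simp add: UNIV_bool padd_def inv_varphi varphi_def add.commute max.commute)
qed

theorem proposition3p1p7:
  fixes x y z :: "real ^ 'n"
  assumes "right_angled x y z"
  shows "(\<forall>p::nat. (pdist p x y)\<^sup>2 = padd p ((pdist p x z)\<^sup>2) ((pdist p y z)\<^sup>2))
    \<and> boxdist x y = max (boxdist x z) (boxdist y z)"
proof -
  \<comment> \<open>Expanding the squared norm of
    \<open>(phi p x - phi p z) - (phi p y - phi p z)\<close> leaves only the cross term, which
    vanishes by orthogonality.\<close>
  have pyth: "(pdist p x y)\<^sup>2 = padd p ((pdist p x z)\<^sup>2) ((pdist p y z)\<^sup>2)" for p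
    using right_angled_imp_orthogonal[OF assms, of p]
    unfolding pdist_power2 padd_root
    by (simp add: power2_norm_eq_inner inner_diff_left inner_diff_right inner_commute algebra_simps)
  have "(\<lambda>p. (pdist p x y)\<^sup>2) \<longlonglongrightarrow> max ((boxdist x z)\<^sup>2) ((boxdist y z)\<^sup>2)"
    unfolding pyth by (intro padd_tendsto_max pdist_power2_tendsto) auto
  then have "(boxdist x y)\<^sup>2 = max ((boxdist x z)\<^sup>2) ((boxdist y z)\<^sup>2)"
    by (rule LIMSEQ_unique[OF pdist_power2_tendsto])
  \<comment> \<open>Squaring is monotone on nonnegative numbers, so it commutes with
    \<open>max\<close> and can be cancelled afterwards.\<close>
  also have "\<dots> = (max (boxdist x z) (boxdist y z))\<^sup>2"
    by (auto simp: max_def power_mono boxdist_nonneg abs_le_square_iff[symmetric])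
  finally have "boxdist x y = max (boxdist x z) (boxdist y z)"
    by (rule power2_eq_imp_eq) (auto simp: boxdist_nonneg le_max_iff_disj)
  with pyth show ?thesis by blast
qed

end
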